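(* Let $n\ge1$ and let $U\subset\mathbb{R}^n$ be a non-empty open bounded definable set. Then $U$ is semi-monotone if and only if for every point $p\in\mathbb{R}^n\setminus U$ the Boolean function $\psi$ at $p$ for $U$ is a non-constant regular function.
   Context: Fix an o-minimal structure over $\mathbb{R}$; all sets are definable in it. Semi-monotone sets. For $1\le j\le n$, $\sigma\in\{<,=,>\}$, $c\in\mathbb{R}$ put $X_{j,\sigma,c}:=\{(x_1,\dots,x_n)\in\mathbb{R}^n : x_j\,\sigma\,c\}$. A (definable) open, possibly empty, bounded set $U\subset\mathbb{R}^n$ is semi-monotone if $U\cap X_{j_1,\sigma_1,c_1}\cap\cdots\cap X_{j_k,\sigma_k,c_k}$ is connected for any $0\le k\le n$, any $1\le j_1<\dots<j_k\le n$, any $\sigma_i\in\{<,=,>\}$ and any $c_i\in\mathbb{R}$ (the empty set counts as connected). Regular Boolean functions. For a Boolean function $\psi:\{0,1\}^n\to\{0,1\}$ in variables $\xi_1,\dots,\xi_n$, let $\psi_{j,c}$ be its restriction to $\{\xi_j=c\}$, $c\in\{0,1\}$, regarded as a function of the remaining $n-1$ variables, and put $E_j(\psi)=\psi_{j,0}\lor\psi_{j,1}$, $A_j(\psi)=\psi_{j,0}\land\psi_{j,1}$. Regularity is defined inductively: every univariate Boolean function is regular; $\psi(\xi_1,\xi_2)$ is regular if the set $\{\psi=1\}$ is neither $\{(1,0),(0,1)\}$ nor $\{(0,0),(1,1)\}$; for $n>2$, $\psi$ is regular if (R1) the restriction of $\psi$ to each Boolean square $\{\xi_{j_1}=c_1,\dots,\xi_{j_{n-2}}=c_{n-2}\}$,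 $1\le j_1<\dots<j_{n-2}\le n$, $c_i\in\{0,1\}$, is regular (as a function of the two remaining variables), and (R2) $E_n(\psi)$ and $A_n(\psi)$ are regular. The function at a point. For $p=(p_1,\dots,p_n)\in\mathbb{R}^n$, the Boolean function $\psi$ at $p$ for $U$ is defined by: $\psi(\xi_1,\dots,\xi_n)=1$ if and only if $U$ has non-empty intersection with the octant with vertex $p$ given by $\{x_i>p_i\text{ for all }i\text{ with }\xi_i=1,\ x_i<p_i\text{ for all }i\text{ with }\xi_i=0\}$. *)

theory Defs
  imports "HOL-Analysis.Analysis"
begin

text \<open>Points of \<open>\<real>\<^sup>n\<close> are the elements of the carrier of \<^const>\<open>Euclidean_space\<close> \<open>n\<close>, that is,
  functions \<^typ>\<open>nat \<Rightarrow> real\<close> vanishing at all indices \<open>\<ge> n\<close>. The coordinates \<open>x\<^sub>1, \<dots>, x\<^sub>n\<close> are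
  numbered from \<open>0\<close> to \<open>n - 1\<close>, and likewise for Boolean variables.\<close>

abbreviation Rn :: "nat \<Rightarrow> (nat \<Rightarrow> real) set" where
  "Rn n \<equiv> topspace (Euclidean_space n)"

section \<open>O-minimal structures over the reals\<close>

text \<open>An o-minimal structure on the ordered set \<open>(\<real>, <)\<close> in the sense of van den Dries, with
  \<open>S m\<close> the family of definable subsets of \<open>\<real>\<^sup>m\<close>. The o-minimal expansions of the real field are
  special cases. Since \<^const>\<open>is_interval\<close> includes singletons, a finite union of points and
  intervals is a finite union of intervals.\<close>

locale o_minimal_structure =
  fixes S :: "nat \<Rightarrow> (nat \<Rightarrow> real) set set"
  assumes subset: "A \<in> S m \<Longrightarrow> A \<subseteq> Rn m"
    and empty: "{} \<in> S m"
    and union: "A \<in> S m \<Longrightarrow> B \<in> S m \<Longrightarrow> A \<union> B \<in> S m"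
    and complement: "A \<in> S m \<Longrightarrow> Rn m - A \<in> S m"
    and times_line: "A \<in> S m \<Longrightarrow> {x \<in> Rn (Suc m). x(m := 0) \<in> A} \<in> S (Suc m)"
    and line_times: "A \<in> S m \<Longrightarrow> {x \<in> Rn (Suc m). (\<lambda>i. x (Suc i)) \<in> A} \<in> S (Suc m)"
    and diagonal: "{x \<in> Rn (Suc m). x 0 = x m} \<in> S (Suc m)"
    and projection: "A \<in> S (Suc m) \<Longrightarrow> (\<lambda>x. x(m := 0)) ` A \<in> S m"
    and order: "{x \<in> Rn 2. x 0 < x 1} \<in> S 2"
    and o_minimal:
      "S 1 = {{x \<in> Rn 1. x 0 \<in> \<Union>F} | F :: real set set. finite F \<and> (\<forall>I\<in>F. is_interval I)}"

section \<open>Semi-monotone sets\<close>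

text \<open>Boundedness is spelled out because the type-class metric on \<^typ>\<open>nat \<Rightarrow> real\<close> is not the
  Euclidean one on \<open>Rn n\<close>.\<close>

definition bounded_Rn :: "nat \<Rightarrow> (nat \<Rightarrow> real) set \<Rightarrow> bool" where
  "bounded_Rn n U \<longleftrightarrow> (\<exists>B. \<forall>x\<in>U. \<forall>i<n. \<bar>x i\<bar> \<le> B)"

definition coord_cond :: "nat \<Rightarrow> nat \<Rightarrow> (real \<Rightarrow> real \<Rightarrow> bool) \<Rightarrow> real \<Rightarrow> (nat \<Rightarrow> real) set" where
  "coord_cond n j \<sigma> c = {x \<in> Rn n. \<sigma> (x j) c}"

text \<open>The indices \<open>j\<^sub>1 < \<dots> < j\<^sub>k\<close> are given by the set \<open>J\<close> of their values.\<close>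

definition semi_monotone ::
    "(nat \<Rightarrow> (nat \<Rightarrow> real) set set) \<Rightarrow> nat \<Rightarrow> (nat \<Rightarrow> real) set \<Rightarrow> bool" where
  "semi_monotone S n U \<longleftrightarrow>
     U \<in> S n \<and> openin (Euclidean_space n) U \<and> bounded_Rn n U \<and>
     (\<forall>J \<sigma> c. J \<subseteq> {..<n} \<longrightarrow> (\<forall>j\<in>J. \<sigma> j \<in> {(<), (=), (>)}) \<longrightarrow>
        connectedin (Euclidean_space n) (U \<inter> (\<Inter>j\<in>J. coord_cond n j (\<sigma> j) (c j))))"

section \<open>Regular Boolean functions\<close>

text \<open>The Boolean cube \<open>{0,1}\<^sup>n\<close>, encoded in the same way as \<open>\<real>\<^sup>n\<close>. Only the values of a Boolean
  function on the cube of its number of variables are relevant.\<close>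

definition bcube :: "nat \<Rightarrow> (nat \<Rightarrow> bool) set" where
  "bcube n = {\<xi>. \<forall>i\<ge>n. \<xi> i = False}"

text \<open>The variables are not renumbered after restriction. In particular, for \<open>\<psi>\<close> in \<open>n\<close> variables,
  \<open>bf_restrict (n - 1) c \<psi>\<close> is a function on \<open>bcube (n - 1)\<close>.\<close>

definition bf_restrict :: "nat \<Rightarrow> bool \<Rightarrow> ((nat \<Rightarrow> bool) \<Rightarrow> bool) \<Rightarrow> (nat \<Rightarrow> bool) \<Rightarrow> bool" where
  "bf_restrict j c \<psi> = (\<lambda>\<xi>. \<psi> (\<xi>(j := c)))"

definition bf_E :: "nat \<Rightarrow> ((nat \<Rightarrow> bool) \<Rightarrow> bool) \<Rightarrow> (nat \<Rightarrow> bool) \<Rightarrow> bool" where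
  "bf_E j \<psi> = (\<lambda>\<xi>. bf_restrict j False \<psi> \<xi> \<or> bf_restrict j True \<psi> \<xi>)"

definition bf_A :: "nat \<Rightarrow> ((nat \<Rightarrow> bool) \<Rightarrow> bool) \<Rightarrow> (nat \<Rightarrow> bool) \<Rightarrow> bool" where
  "bf_A j \<psi> = (\<lambda>\<xi>. bf_restrict j False \<psi> \<xi> \<and> bf_restrict j True \<psi> \<xi>)"

definition regular2 :: "(bool \<Rightarrow> bool \<Rightarrow> bool) \<Rightarrow> bool" where
  "regular2 \<phi> \<longleftrightarrow>
     {(s, t). \<phi> s t} \<noteq> {(True, False), (False, True)} \<and>
     {(s, t). \<phi> s t} \<noteq> {(False, False), (True, True)}"

text \<open>In the last clause, a Boolean square is given by its two free variables \<open>a < b\<close> and a point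
  \<open>\<eta>\<close> of the cube carrying the values of the remaining, fixed, variables. The value for zero
  variables is a convention.\<close>

fun bf_regular :: "nat \<Rightarrow> ((nat \<Rightarrow> bool) \<Rightarrow> bool) \<Rightarrow> bool" where
  "bf_regular 0 \<psi> \<longleftrightarrow> True"
| "bf_regular (Suc 0) \<psi> \<longleftrightarrow> True"
| "bf_regular (Suc (Suc 0)) \<psi> \<longleftrightarrow> regular2 (\<lambda>s t. \<psi> ((\<lambda>_. False)(0 := s, 1 := t)))"
| "bf_regular (Suc (Suc (Suc m))) \<psi> \<longleftrightarrow>
     (\<forall>a b. a < b \<longrightarrow> b < Suc (Suc (Suc m)) \<longrightarrow>
        (\<forall>\<eta>\<in>bcube (Suc (Suc (Suc m))). regular2 (\<lambda>s t. \<psi> (\<eta>(a := s, b := t))))) \<and>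
     bf_regular (Suc (Suc m)) (bf_E (Suc (Suc m)) \<psi>) \<and>
     bf_regular (Suc (Suc m)) (bf_A (Suc (Suc m)) \<psi>)"

definition bf_nonconstant :: "nat \<Rightarrow> ((nat \<Rightarrow> bool) \<Rightarrow> bool) \<Rightarrow> bool" where
  "bf_nonconstant n \<psi> \<longleftrightarrow> (\<exists>\<xi>\<in>bcube n. \<exists>\<eta>\<in>bcube n. \<psi> \<xi> \<noteq> \<psi> \<eta>)"

section \<open>The Boolean function at a point\<close>

definition octant :: "nat \<Rightarrow> (nat \<Rightarrow> real) \<Rightarrow> (nat \<Rightarrow> bool) \<Rightarrow> (nat \<Rightarrow> real) set" where
  "octant n p \<xi> = {x \<in> Rn n. \<forall>i<n. if \<xi> i then x i > p i else x i < p i}"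

definition bf_at :: "nat \<Rightarrow> (nat \<Rightarrow> real) set \<Rightarrow> (nat \<Rightarrow> real) \<Rightarrow> (nat \<Rightarrow> bool) \<Rightarrow> bool" where
  "bf_at n U p \<xi> \<longleftrightarrow> U \<inter> octant n p \<xi> \<noteq> {}"

end

theory Submission
  imports Defs
begin

text \<open>The proof is an induction on the dimension that strips off the last coordinate \<open>x\<^sub>m\<close>. Both sides
  of the equivalence behave well under the two operations that lower the dimension: the projection
  (\<open>shadow\<close>) of \<open>U\<close> along \<open>x\<^sub>m\<close> and the section of \<open>U\<close> by \<open>x\<^sub>m = c\<close>. For the Boolean function \<open>\<psi>\<close> of
  \<open>U\<close> at \<open>p\<close>, openness of \<open>U\<close> gives that \<open>E \<psi>\<close> is the function of the projection
  (\<open>bf_E_bf_at\<close>), and \<open>A \<psi>\<close> is the function of the section through \<open>p\<close> provided that \<open>x\<^sub>m\<close> takes an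
  interval of values on each set cut out of \<open>U\<close> by strict conditions on the other coordinates
  (\<open>bf_A_bf_at\<close>).

  If \<open>U\<close> is semi-monotone, so are its projections and sections, and (R2) follows by induction. (R1) is
  the intermediate value theorem: if a connected slice of \<open>U\<close> has points on both sides of \<open>x\<^sub>a = p\<^sub>a\<close>, it
  meets this hyperplane, and a point there can be pushed to either side. If all octants at \<open>p\<close> meet \<open>U\<close>, then
  all octants of the section through \<open>p\<close> meet the section, and induction gives \<open>p \<in> U\<close>.

  Conversely, suppose that the functions at all points outside \<open>U\<close> are regular and not constantly
  true. Then \<open>U\<close> meets each line parallel to an axis in an interval, since all octants at a point
  strictly between two points of \<open>U\<close> on such a line meet \<open>U\<close>. The projection inherits the hypothesis
  (\<open>regular_outside_shadow\<close>); this is the main step. By induction the slices of the projection are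
  connected, and as the projection is an open map with interval fibres, so are the slices of \<open>U\<close> without a
  condition on \<open>x\<^sub>m\<close>. Now \<open>A \<psi>\<close> is known to be the function of the section, so the sections inherit the
  hypothesis too, and by induction their slices are connected. These are the fibres of \<open>x\<^sub>m\<close>, which
  is an open map on each slice; hence slices with a condition \<open>x\<^sub>m < c\<close> or \<open>x\<^sub>m > c\<close> are connected.

  The main step needs that no function of the projection at a point outside it is constantly true.
  The combinatorial reason is that the true set and the false set of a regular function are
  connected in the graph of the cube (\<open>bf_regular_connected\<close>).\<close>

section \<open>Connectedness of regular Boolean functions\<close>

text \<open>If the fibres over both values of \<open>s\<close> are non-empty, they share a value \<open>t\<close>: this is the
  shape in which regularity is produced by a connectedness argument and used to lift paths in the cube.\<close>

lemma regular2_iff_common_value: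
  "regular2 \<phi> \<longleftrightarrow> ((\<exists>t. \<phi> False t) \<and> (\<exists>t. \<phi> True t) \<longrightarrow> (\<exists>t. \<phi> False t \<and> \<phi> True t))"
  unfolding regular2_def set_eq_iff split_paired_All all_bool_eq ex_bool_eq by simp blast

lemma regular2_Not: "regular2 (\<lambda>s t. \<not> \<phi> s t) \<longleftrightarrow> regular2 \<phi>"
  unfolding regular2_iff_common_value ex_bool_eq by blast

text \<open>In two variables \<open>E \<psi>\<close> and \<open>A \<psi>\<close> are univariate, hence regular, so the recursion has the
  same form in all dimensions. This removes the special low-dimensional cases from later inductions.\<close>

lemma bf_regular_Suc:
  "bf_regular (Suc m) \<psi> \<longleftrightarrow>
     (\<forall>a b. a < b \<longrightarrow> b < Suc m \<longrightarrow> (\<forall>\<eta>\<in>bcube (Suc m). regular2 (\<lambda>s t. \<psi> (\<eta>(a := s, b := t))))) \<and>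
     bf_regular m (bf_E m \<psi>) \<and> bf_regular m (bf_A m \<psi>)"
proof (cases m)
  case 0
  then show ?thesis by auto
next
  case (Suc k)
  show ?thesis
  proof (cases k)
    case 0
    have eq: "\<eta>(0 := s, Suc 0 := t) = (\<lambda>_. False)(0 := s, 1 := t)" if "\<eta> \<in> bcube 2" for \<eta> s t
      using that by (auto simp: bcube_def fun_eq_iff)
    have "regular2 (\<lambda>s t. \<psi> (\<eta>(0 := s, Suc 0 := t))) \<longleftrightarrow>
        regular2 (\<lambda>s t. \<psi> ((\<lambda>_. False)(0 := s, 1 := t)))" if "\<eta> \<in> bcube 2" for \<eta>
      by (simp only: eq[OF that])
    moreover have "(\<lambda>_. False) \<in> bcube 2"
      by (simp add: bcube_def)
    ultimately have squares: "(\<forall>\<eta>\<in>bcube 2. regular2 (\<lambda>s t. \<psi> (\<eta>(0 := s, Suc 0 := t)))) \<longleftrightarrow>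
        regular2 (\<lambda>s t. \<psi> ((\<lambda>_. False)(0 := s, 1 := t)))"
      by blast
    have "m = Suc 0" using Suc 0 by simp
    have "(\<forall>a b. a < b \<longrightarrow> b < Suc m \<longrightarrow> P a b) \<longleftrightarrow> P 0 (Suc 0)" for P :: "nat \<Rightarrow> nat \<Rightarrow> bool"
      unfolding \<open>m = Suc 0\<close> by (auto simp: less_Suc_eq)
    then show ?thesis
      using squares unfolding \<open>m = Suc 0\<close> by (simp only: bf_regular.simps numeral_2_eq_2 simp_thms)
  next
    case (Suc l)
    with \<open>m = Suc k\<close> show ?thesis by simp
  qed
qed

text \<open>Negation exchanges \<open>E\<close> and \<open>A\<close>, and the two forbidden squares are complements of each
  other.\<close>

lemma bf_regular_Not: "bf_regular n (\<lambda>\<xi>. \<not> \<psi> \<xi>) \<longleftrightarrow> bf_regular n \<psi>"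
proof (induction n arbitrary: \<psi>)
  case (Suc m)
  have "bf_E m (\<lambda>\<xi>. \<not> \<psi> \<xi>) = (\<lambda>\<xi>. \<not> bf_A m \<psi> \<xi>)" "bf_A m (\<lambda>\<xi>. \<not> \<psi> \<xi>) = (\<lambda>\<xi>. \<not> bf_E m \<psi> \<xi>)"
    by (auto simp: bf_E_def bf_A_def bf_restrict_def)
  then show ?case
    by (auto simp: bf_regular_Suc regular2_Not Suc.IH)
qed simp

text \<open>The square spanned by the directions \<open>i\<close> and \<open>m\<close> at \<open>\<eta>\<close> would otherwise be one of the two
  forbidden diagonals. This is what lifts an edge of \<open>{E \<psi> = 1}\<close> to an edge of \<open>{\<psi> = 1}\<close>.\<close>

lemma regular_square_common_value:
  assumes "bf_regular (Suc m) \<psi>" "i < m" "\<eta> \<in> bcube m"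
    and "bf_E m \<psi> \<eta>" "bf_E m \<psi> (\<eta>(i := \<not> \<eta> i))"
  shows "\<exists>r. \<psi> (\<eta>(m := r)) \<and> \<psi> (\<eta>(i := \<not> \<eta> i, m := r))"
proof -
  have "\<eta> \<in> bcube (Suc m)"
    using assms(3) by (auto simp: bcube_def)
  then have reg: "regular2 (\<lambda>s t. \<psi> (\<eta>(i := s, m := t)))"
    using assms(1,2) by (simp add: bf_regular_Suc)
  have [simp]: "\<eta>(i := \<eta> i, m := t) = \<eta>(m := t)" for t
    by simp
  have "\<exists>t. \<psi> (\<eta>(i := s, m := t))" for s
    using assms(4,5) by (cases "s = \<eta> i") (auto simp: bf_E_def bf_restrict_def)
  then have "\<exists>t. \<psi> (\<eta>(i := False, m := t)) \<and> \<psi> (\<eta>(i := True, m := t))"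
    using reg unfolding regular2_iff_common_value by blast
  then obtain t where t: "\<psi> (\<eta>(i := s, m := t))" for s
    by (metis (full_types))
  then show ?thesis
    using t[of "\<eta> i"] by auto
qed

definition flip_step :: "nat \<Rightarrow> ((nat \<Rightarrow> bool) \<Rightarrow> bool) \<Rightarrow> (nat \<Rightarrow> bool) \<Rightarrow> (nat \<Rightarrow> bool) \<Rightarrow> bool" where
  "flip_step n f \<xi> \<eta> \<longleftrightarrow>
     \<xi> \<in> bcube n \<and> \<eta> \<in> bcube n \<and> f \<xi> \<and> f \<eta> \<and> (\<exists>i<n. \<eta> = \<xi>(i := \<not> \<xi> i))"

lemma bcube_Suc_upd: "\<xi> \<in> bcube m \<Longrightarrow> \<xi>(m := s) \<in> bcube (Suc m)"
  by (auto simp: bcube_def)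

lemma bcube_upd_False: "\<xi> \<in> bcube (Suc m) \<Longrightarrow> \<xi>(m := False) \<in> bcube m"
  by (auto simp: bcube_def le_Suc_eq Suc_le_eq)

lemma bf_E_upd [simp]: "bf_E m \<psi> (\<xi>(m := s)) = bf_E m \<psi> \<xi>"
  by (simp add: bf_E_def bf_restrict_def)

lemma bf_E_I: "\<psi> (\<xi>(m := s)) \<Longrightarrow> bf_E m \<psi> \<xi>"
  by (cases s) (auto simp: bf_E_def bf_restrict_def)

lemma flip_step_last:
  assumes "\<xi> \<in> bcube m" "f (\<xi>(m := r))" "f (\<xi>(m := s))"
  shows "(flip_step (Suc m) f)\<^sup>*\<^sup>* (\<xi>(m := r)) (\<xi>(m := s))"
proof (cases "r = s")
  case False
  then have "\<exists>i<Suc m. \<xi>(m := s) = (\<xi>(m := r))(i := \<not> (\<xi>(m := r)) i)"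
    by (intro exI[of _ m]) auto
  then have "flip_step (Suc m) f (\<xi>(m := r)) (\<xi>(m := s))"
    unfolding flip_step_def using assms bcube_Suc_upd by blast
  then show ?thesis by (rule r_into_rtranclp[of "flip_step (Suc m) f"])
qed simp

text \<open>A path between the images of \<open>\<xi>\<close> and \<open>\<eta>\<close> in \<open>{E f = 1}\<close>, which exists by induction, lifts:
  each of its edges has a lift by regularity of a square, and within a fibre the last bit can
  be flipped freely.\<close>

lemma bf_regular_connected:
  assumes "bf_regular n f" "\<xi> \<in> bcube n" "\<eta> \<in> bcube n" "f \<xi>" "f \<eta>"
  shows "(flip_step n f)\<^sup>*\<^sup>* \<xi> \<eta>"
  using assms
proof (induction n arbitrary: f \<xi> \<eta>)
  case 0
  then have "\<xi> = \<eta>" by (auto simp: bcube_def fun_eq_iff)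
  then show ?case by simp
next
  case (Suc m)
  let ?g = "bf_E m f"
  have g: "?g (\<xi>(m := False))" "?g (\<eta>(m := False))"
    using Suc.prems bf_E_I[of f \<xi> m "\<xi> m"] bf_E_I[of f \<eta> m "\<eta> m"] by auto
  have "bf_regular m ?g"
    using Suc.prems(1) by (simp add: bf_regular_Suc)
  then have "(flip_step m ?g)\<^sup>*\<^sup>* (\<xi>(m := False)) (\<eta>(m := False))"
    using Suc.IH bcube_upd_False Suc.prems(2,3) g by blast
  \<comment> \<open>the level \<open>s\<close> is arbitrary, as the lift of the path may arrive at either end of the fibre\<close>
  then have "f ((\<eta>(m := False))(m := s)) \<longrightarrow>
      (flip_step (Suc m) f)\<^sup>*\<^sup>* \<xi> ((\<eta>(m := False))(m := s))" for s
  proof (induction arbitrary: s rule: rtranclp_induct)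
    case base
    have "f ((\<xi>(m := False))(m := \<xi> m))"
      using Suc.prems by simp
    from flip_step_last[of _ _ f "\<xi> m" s, OF bcube_upd_False[OF Suc.prems(2)] this] show ?case
      unfolding fun_upd_upd fun_upd_triv by blast
  next
    case (step \<zeta> \<theta>)
    then obtain i where i: "i < m" "\<zeta> \<in> bcube m" "\<theta> \<in> bcube m" "?g \<zeta>" "?g \<theta>" "\<theta> = \<zeta>(i := \<not> \<zeta> i)"
      by (auto simp: flip_step_def)
    then obtain r where r: "f (\<zeta>(m := r))" "f (\<theta>(m := r))"
      using regular_square_common_value[of m f i \<zeta>] Suc.prems(1) by auto
    have "\<theta>(m := r) = (\<zeta>(m := r))(i := \<not> (\<zeta>(m := r)) i)"
      using i(1,6) by (auto simp: fun_eq_iff)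
    then have "flip_step (Suc m) f (\<zeta>(m := r)) (\<theta>(m := r))"
      unfolding flip_step_def using i r bcube_Suc_upd less_SucI by blast
    with step.IH r have "(flip_step (Suc m) f)\<^sup>*\<^sup>* \<xi> (\<theta>(m := r))"
      by (meson rtranclp.rtrancl_into_rtrancl)
    then show ?case
      using flip_step_last[of \<theta> m f r s, OF i(3) r(2)] rtranclp_trans[of "flip_step (Suc m) f"] by blast
  qed
  from this[of "\<eta> m"] show ?case
    using Suc.prems by simp
qed

lemma finite_bcube: "finite (bcube n)"
proof (induction n)
  case 0
  have "bcube 0 = {\<lambda>_. False}" by (auto simp: bcube_def)
  then show ?case by simp
next
  case (Suc m)
  have "bcube (Suc m) \<subseteq> (\<lambda>(\<xi>, s). \<xi>(m := s)) ` (bcube m \<times> UNIV)"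
  proof
    fix \<xi> assume "\<xi> \<in> bcube (Suc m)"
    then have "(\<xi>(m := False), \<xi> m) \<in> bcube m \<times> UNIV"
      using bcube_upd_False by blast
    then show "\<xi> \<in> (\<lambda>(\<xi>, s). \<xi>(m := s)) ` (bcube m \<times> UNIV)"
      by (rule rev_image_eqI) simp
  qed
  moreover have "finite (bcube m \<times> (UNIV :: bool set))"
    using Suc by simp
  ultimately show ?case
    using finite_surj by blast
qed

section \<open>Open sets and octants\<close>

lemma Euclidean_space_eq: "Euclidean_space n = top_of_set {x. \<forall>i\<ge>n. x i = 0}"
  by (simp add: Euclidean_space_def euclidean_product_topology)

lemma openin_Rn_iff: "openin (Euclidean_space n) U \<longleftrightarrow> (\<exists>G. open G \<and> U = Rn n \<inter> G)"
  by (simp add: Euclidean_space_eq openin_open)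

lemma connectedin_Rn_iff: "connectedin (Euclidean_space n) A \<longleftrightarrow> A \<subseteq> Rn n \<and> connected A"
  by (auto simp: Euclidean_space_eq connectedin_subtopology)

lemma Rn_upd: "x \<in> Rn n \<Longrightarrow> j < n \<Longrightarrow> x(j := c) \<in> Rn n"
  by (auto simp: topspace_Euclidean_space)

lemma Rn_Suc_upd: "x \<in> Rn m \<Longrightarrow> x(m := c) \<in> Rn (Suc m)"
  by (auto simp: topspace_Euclidean_space)

lemma Rn_Suc_forget: "x \<in> Rn (Suc m) \<Longrightarrow> x(m := 0) \<in> Rn m"
  by (auto simp: topspace_Euclidean_space le_Suc_eq Suc_le_eq)

lemma continuous_on_upd_coordinate:
  fixes x :: "nat \<Rightarrow> real"
  shows "continuous_on S (\<lambda>t. x(j := t))"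
proof (rule continuous_on_coordinatewise_then_product)
  fix i show "continuous_on S (\<lambda>t. (x(j := t)) i)"
    by (cases "i = j") (auto intro: continuous_intros)
qed

lemma continuous_on_coordinate:
  fixes S :: "(nat \<Rightarrow> real) set"
  shows "continuous_on S (\<lambda>x. x i)"
  by (rule continuous_on_subset[OF continuous_on_product_coordinates]) simp

lemma continuous_on_upd_point:
  fixes S :: "(nat \<Rightarrow> real) set"
  shows "continuous_on S (\<lambda>x. x(j := c))"
proof (rule continuous_on_coordinatewise_then_product)
  fix i show "continuous_on S (\<lambda>x. (x(j := c)) i)"
    by (cases "i = j") (auto intro: continuous_on_coordinate)
qed

lemma open_vimage_upd_coordinate:
  fixes x :: "nat \<Rightarrow> real"
  shows "open G \<Longrightarrow> open {t. x(j := t) \<in> G}"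
  using open_vimage[OF _ continuous_on_upd_coordinate, of G x j] by (simp add: vimage_def)

lemma open_vimage_upd_point:
  fixes G :: "(nat \<Rightarrow> real) set"
  shows "open G \<Longrightarrow> open {x. x(j := c) \<in> G}"
  using open_vimage[OF _ continuous_on_upd_point, of G j c] by (simp add: vimage_def)

text \<open>Perturbing a point in one chosen direction is enough to push it into an octant, and reduces
  openness in the product topology to openness on the real line.\<close>

lemma openin_Rn_move:
  assumes "openin (Euclidean_space n) U" "x \<in> U" "d \<in> Rn n"
  shows "\<exists>s>0. (\<lambda>i. x i + s * d i) \<in> U"
proof -
  obtain G where G: "open G" "U = Rn n \<inter> G"
    using assms(1) openin_Rn_iff by auto
  have "continuous_on UNIV (\<lambda>(s::real) i. x i + s * d i)"
    by (rule continuous_on_coordinatewise_then_product) (auto intro!: continuous_intros)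
  then have "open {s::real. (\<lambda>i. x i + s * d i) \<in> G}"
    using open_vimage[OF G(1)] by (fastforce simp: vimage_def)
  moreover have "0 \<in> {s::real. (\<lambda>i. x i + s * d i) \<in> G}"
    using assms(2) G(2) by simp
  ultimately obtain e where e: "e > 0" "ball 0 e \<subseteq> {s::real. (\<lambda>i. x i + s * d i) \<in> G}"
    using open_contains_ball by blast
  have "e/2 \<in> ball 0 e"
    using e(1) by simp
  with e(2) have "(\<lambda>i. x i + e/2 * d i) \<in> G"
    by blast
  moreover have "(\<lambda>i. x i + e/2 * d i) \<in> Rn n"
    using assms(2,3) G(2) by (auto simp: topspace_Euclidean_space)
  ultimately show ?thesis
    using G(2) e(1) by (intro exI[of _ "e/2"]) auto
qed

lemma bf_at_iff:
  assumes "U \<subseteq> Rn n"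
  shows "bf_at n U p \<xi> \<longleftrightarrow> (\<exists>x\<in>U. \<forall>i<n. if \<xi> i then x i > p i else x i < p i)"
  using assms unfolding bf_at_def octant_def by blast

text \<open>A point of an open set lies in the closure of every octant whose strict sides agree with it on
  the coordinates where it differs from \<open>p\<close>; push the remaining coordinates to the desired side.\<close>

lemma bf_at_I:
  assumes "openin (Euclidean_space n) U" "x \<in> U"
    and sides: "\<And>i. i < n \<Longrightarrow> x i \<noteq> p i \<Longrightarrow> \<xi> i \<longleftrightarrow> x i > p i"
  shows "bf_at n U p \<xi>"
proof -
  define d :: "nat \<Rightarrow> real" where
    "d i = (if i < n \<and> x i = p i then if \<xi> i then 1 else - 1 else 0)" for i
  have "d \<in> Rn n" by (auto simp: d_def topspace_Euclidean_space)
  then obtain s where s: "s > 0" "(\<lambda>i. x i + s * d i) \<in> U"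
    using openin_Rn_move[OF assms(1,2)] by blast
  have "if \<xi> i then x i + s * d i > p i else x i + s * d i < p i" if "i < n" for i
    using sides[OF that] that s(1) by (cases "x i = p i") (auto simp: d_def)
  moreover have "U \<subseteq> Rn n"
    using assms(1) openin_Rn_iff by auto
  ultimately show ?thesis
    unfolding bf_at_iff[OF \<open>U \<subseteq> Rn n\<close>] by (intro bexI[OF _ s(2)]) blast
qed

lemma connected_coordinate_value:
  fixes V :: "(nat \<Rightarrow> real) set"
  assumes "connected V" "x \<in> V" "y \<in> V" "x j < c" "c < y j"
  shows "\<exists>z\<in>V. z j = c"
proof -
  have "connected ((\<lambda>x. x j) ` V)"
    using assms(1) connected_continuous_image continuous_on_coordinate by blast
  then have "c \<in> (\<lambda>x. x j) ` V"
    using connectedD_interval[of "(\<lambda>x. x j) ` V" "x j" "y j" c] assms by auto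
  then show ?thesis by auto
qed

section \<open>Projections and sections\<close>

definition shadow :: "nat \<Rightarrow> (nat \<Rightarrow> real) set \<Rightarrow> (nat \<Rightarrow> real) set" where
  "shadow m U = (\<lambda>x. x(m := 0)) ` U"

definition cross_section :: "nat \<Rightarrow> real \<Rightarrow> (nat \<Rightarrow> real) set \<Rightarrow> (nat \<Rightarrow> real) set" where
  "cross_section m c U = {x \<in> Rn m. x(m := c) \<in> U}"

lemma openin_cross_section:
  assumes "openin (Euclidean_space (Suc m)) U"
  shows "openin (Euclidean_space m) (cross_section m c U)"
proof -
  obtain G where G: "open G" "U = Rn (Suc m) \<inter> G"
    using assms openin_Rn_iff by auto
  have "cross_section m c U = Rn m \<inter> {x. x(m := c) \<in> G}"
    using Rn_Suc_upd[of _ m c] G(2) by (auto simp: cross_section_def)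
  then show ?thesis
    using openin_Rn_iff open_vimage_upd_point[OF G(1)] by blast
qed

lemma shadow_eq_Union:
  assumes "U \<subseteq> Rn (Suc m)"
  shows "shadow m U = (\<Union>c. cross_section m c U)"
proof
  show "shadow m U \<subseteq> (\<Union>c. cross_section m c U)"
  proof
    fix y assume "y \<in> shadow m U"
    then obtain x where "x \<in> U" "y = x(m := 0)"
      by (auto simp: shadow_def)
    then have "y \<in> cross_section m (x m) U"
      using assms Rn_Suc_forget[of x m] by (auto simp: cross_section_def)
    then show "y \<in> (\<Union>c. cross_section m c U)" by blast
  qed
  show "(\<Union>c. cross_section m c U) \<subseteq> shadow m U"
  proof
    fix y assume "y \<in> (\<Union>c. cross_section m c U)"
    then obtain c where c: "y \<in> Rn m" "y(m := c) \<in> U"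
      by (auto simp: cross_section_def)
    then have "y = (y(m := c))(m := 0)"
      by (auto simp: topspace_Euclidean_space)
    with c show "y \<in> shadow m U"
      unfolding shadow_def by blast
  qed
qed

text \<open>The projection is a union of open sections, since all sections are placed in the same
  \<open>\<real>\<^sup>m\<close>.\<close>

lemma openin_shadow:
  assumes "openin (Euclidean_space (Suc m)) U"
  shows "openin (Euclidean_space m) (shadow m U)"
proof -
  have "U \<subseteq> Rn (Suc m)"
    using assms openin_subset by blast
  then show ?thesis
    using openin_cross_section[OF assms] by (auto simp: shadow_eq_Union)
qed

lemma bf_at_Suc_upd:
  assumes "U \<subseteq> Rn (Suc m)"
  shows "bf_at (Suc m) U p (\<xi>(m := s)) \<longleftrightarrow>
    (\<exists>x\<in>U. (\<forall>i<m. if \<xi> i then x i > p i else x i < p i) \<and> (if s then x m > p m else x m < p m))"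
  unfolding bf_at_iff[OF assms] by (auto simp: less_Suc_eq all_conj_distrib)

lemma bf_at_shadow_iff:
  assumes "U \<subseteq> Rn (Suc m)"
  shows "bf_at m (shadow m U) p \<xi> \<longleftrightarrow> (\<exists>x\<in>U. \<forall>i<m. if \<xi> i then x i > p i else x i < p i)"
proof -
  have "shadow m U \<subseteq> Rn m"
    using assms by (force simp: shadow_def intro: Rn_Suc_forget)
  then show ?thesis
    by (auto simp: bf_at_iff shadow_def)
qed

lemma bf_at_cross_section_iff:
  assumes "U \<subseteq> Rn (Suc m)"
  shows "bf_at m (cross_section m c U) p \<xi> \<longleftrightarrow>
    (\<exists>x\<in>U. x m = c \<and> (\<forall>i<m. if \<xi> i then x i > p i else x i < p i))" (is "?L \<longleftrightarrow> ?R")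
proof
  have sub: "cross_section m c U \<subseteq> Rn m"
    by (auto simp: cross_section_def)
  show ?R if ?L
  proof -
    from that obtain x where x: "x(m := c) \<in> U" "\<forall>i<m. if \<xi> i then x i > p i else x i < p i"
      unfolding bf_at_iff[OF sub] unfolding cross_section_def by blast
    then show ?R by (intro bexI[of _ "x(m := c)"]) auto
  qed
  show ?L if ?R
  proof -
    from that obtain x where x: "x \<in> U" "x m = c" "\<forall>i<m. if \<xi> i then x i > p i else x i < p i"
      by blast
    then have "x(m := 0) \<in> cross_section m c U"
      using assms Rn_Suc_forget[of x m] by (auto simp: cross_section_def)
    with x(3) show ?L
      unfolding bf_at_iff[OF sub] by (intro bexI[of _ "x(m := 0)"]) auto
  qed
qed

text \<open>A point of \<open>U\<close> over an octant of \<open>\<real>\<^sup>m\<close> that has last coordinate exactly \<open>p\<^sub>m\<close> can be moved off this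
  hyperplane, so it is found on one of its two sides.\<close>

lemma bf_E_bf_at:
  assumes "openin (Euclidean_space (Suc m)) U"
  shows "bf_E m (bf_at (Suc m) U p) = bf_at m (shadow m U) p"
proof
  fix \<xi>
  have sub: "U \<subseteq> Rn (Suc m)"
    using assms openin_subset by blast
  have "bf_E m (bf_at (Suc m) U p) \<xi>"
    if "x \<in> U" "\<forall>i<m. if \<xi> i then x i > p i else x i < p i" for x
  proof -
    have "bf_at (Suc m) U p (\<xi>(m := x m > p m))"
      using that by (intro bf_at_I[OF assms]) (force simp: less_Suc_eq split: if_splits)+
    then show ?thesis by (rule bf_E_I)
  qed
  moreover have "\<exists>x\<in>U. \<forall>i<m. if \<xi> i then x i > p i else x i < p i" if "bf_E m (bf_at (Suc m) U p) \<xi>"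
    using that unfolding bf_E_def bf_restrict_def bf_at_Suc_upd[OF sub] by blast
  ultimately show "bf_E m (bf_at (Suc m) U p) \<xi> = bf_at m (shadow m U) p \<xi>"
    unfolding bf_at_shadow_iff[OF sub] by blast
qed

text \<open>Points on both sides of \<open>x\<^sub>m = p\<^sub>m\<close> over the same octant are joined within \<open>U\<close> over that
  octant, so the hyperplane is met; conversely a point of the hyperplane can be moved to both sides.\<close>

lemma bf_A_bf_at:
  assumes "openin (Euclidean_space (Suc m)) U"
    and conn: "connected (U \<inter> {x. \<forall>i<m. if \<xi> i then x i > p i else x i < p i})"
  shows "bf_A m (bf_at (Suc m) U p) \<xi> = bf_at m (cross_section m (p m) U) p \<xi>"
proof -
  have sub: "U \<subseteq> Rn (Suc m)"
    using assms openin_subset by blast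
  have "bf_at (Suc m) U p (\<xi>(m := s))"
    if "x \<in> U" "x m = p m" "\<forall>i<m. if \<xi> i then x i > p i else x i < p i" for s x
    using that by (intro bf_at_I[OF assms(1)]) (force simp: less_Suc_eq split: if_splits)+
  moreover have "\<exists>z\<in>U. z m = p m \<and> (\<forall>i<m. if \<xi> i then z i > p i else z i < p i)"
    if "bf_at (Suc m) U p (\<xi>(m := False))" "bf_at (Suc m) U p (\<xi>(m := True))"
    using that connected_coordinate_value[OF conn, of _ _ m "p m"]
    unfolding bf_at_Suc_upd[OF sub] by fastforce
  ultimately show ?thesis
    unfolding bf_at_cross_section_iff[OF sub] bf_A_def bf_restrict_def by blast
qed

section \<open>Sets with connected slices\<close>

abbreviation slice ::
    "nat set \<Rightarrow> (nat \<Rightarrow> real \<Rightarrow> real \<Rightarrow> bool) \<Rightarrow> (nat \<Rightarrow> real) \<Rightarrow> (nat \<Rightarrow> real) set" where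
  "slice J \<sigma> c \<equiv> {x. \<forall>j\<in>J. \<sigma> j (x j) (c j)}"

definition slices_connected :: "nat \<Rightarrow> (nat \<Rightarrow> real) set \<Rightarrow> bool" where
  "slices_connected n U \<longleftrightarrow>
     (\<forall>J \<sigma> c. J \<subseteq> {..<n} \<longrightarrow> (\<forall>j\<in>J. \<sigma> j \<in> {(<), (=), (>)}) \<longrightarrow> connected (U \<inter> slice J \<sigma> c))"

lemma slices_connectedD:
  assumes "slices_connected n U" "J \<subseteq> {..<n}" "\<forall>j\<in>J. \<sigma> j \<in> {(<), (=), (>)}"
  shows "connected (U \<inter> slice J \<sigma> c)"
  using assms(1)[unfolded slices_connected_def, rule_format, OF assms(2)] assms(3) by blast

lemma semi_monotone_iff_slices_connected:
  assumes "U \<in> S n" "openin (Euclidean_space n) U" "bounded_Rn n U"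
  shows "semi_monotone S n U \<longleftrightarrow> slices_connected n U"
proof -
  have "U \<subseteq> Rn n" using assms(2) openin_subset by blast
  then have "U \<inter> (\<Inter>j\<in>J. coord_cond n j (\<sigma> j) (c j)) = U \<inter> slice J \<sigma> c" for J \<sigma> c
    by (auto simp: coord_cond_def)
  with assms \<open>U \<subseteq> Rn n\<close> show ?thesis
    unfolding semi_monotone_def slices_connected_def by (auto simp: connectedin_Rn_iff)
qed

lemma slices_connected_octant:
  assumes "slices_connected n U" "J \<subseteq> {..<n}"
  shows "connected (U \<inter> {x. \<forall>i\<in>J. if \<xi> i then x i > p i else x i < p i})"
proof -
  let ?\<sigma> = "(\<lambda>i. if \<xi> i then (>) else (<)) :: nat \<Rightarrow> real \<Rightarrow> real \<Rightarrow> bool"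
  have "{x. \<forall>i\<in>J. if \<xi> i then x i > p i else x i < p i} = slice J ?\<sigma> p"
    by (intro Collect_cong ball_cong) auto
  moreover have "\<forall>i\<in>J. ?\<sigma> i \<in> {(<), (=), (>)}"
    by simp
  then have "connected (U \<inter> slice J ?\<sigma> p)"
    by (rule slices_connectedD[OF assms])
  ultimately show ?thesis
    by (simp only:)
qed

lemma slices_connected_shadow:
  assumes "slices_connected (Suc m) U"
  shows "slices_connected m (shadow m U)"
  unfolding slices_connected_def
proof (intro allI impI)
  fix J and \<sigma> :: "nat \<Rightarrow> real \<Rightarrow> real \<Rightarrow> bool" and c :: "nat \<Rightarrow> real"
  assume J: "J \<subseteq> {..<m}" "\<forall>j\<in>J. \<sigma> j \<in> {(<), (=), (>)}"
  then have "connected (U \<inter> slice J \<sigma> c)"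
    by (intro slices_connectedD[OF assms]) auto
  then have "connected ((\<lambda>x. x(m := 0)) ` (U \<inter> slice J \<sigma> c))"
    by (rule connected_continuous_image[OF continuous_on_upd_point])
  also have "(\<lambda>x. x(m := 0)) ` (U \<inter> slice J \<sigma> c) = shadow m U \<inter> slice J \<sigma> c"
  proof -
    have "x(m := 0) \<in> slice J \<sigma> c \<longleftrightarrow> x \<in> slice J \<sigma> c" for x
      using J(1) by fastforce
    then show ?thesis unfolding shadow_def by blast
  qed
  finally show "connected (shadow m U \<inter> slice J \<sigma> c)" .
qed

lemma cross_section_slice_image:
  assumes "U \<subseteq> Rn (Suc m)" "J \<subseteq> {..<m}"
  shows "(\<lambda>x. x(m := 0)) ` (U \<inter> slice J \<sigma> c \<inter> {x. x m = t}) = cross_section m t U \<inter> slice J \<sigma> c"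
    and "(\<lambda>x. x(m := t)) ` (cross_section m t U \<inter> slice J \<sigma> c) = U \<inter> slice J \<sigma> c \<inter> {x. x m = t}"
proof -
  have slice_upd: "x(m := a) \<in> slice J \<sigma> c \<longleftrightarrow> x \<in> slice J \<sigma> c" for a x
    using assms(2) by fastforce
  have sec: "x(m := 0) \<in> cross_section m t U" if "x \<in> U" "x m = t" for x
    using that assms(1) Rn_Suc_forget[of x m] by (auto simp: cross_section_def)
  have zero: "x = (x(m := t))(m := 0)" if "x \<in> Rn m" for x
    using that by (auto simp: topspace_Euclidean_space)
  have reinsert: "x = (x(m := 0))(m := t)" if "x m = t" for x :: "nat \<Rightarrow> real"
    using that by auto
  show "(\<lambda>x. x(m := 0)) ` (U \<inter> slice J \<sigma> c \<inter> {x. x m = t}) = cross_section m t U \<inter> slice J \<sigma> c"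
  proof (intro set_eqI iffI)
    fix y assume y: "y \<in> cross_section m t U \<inter> slice J \<sigma> c"
    then have yt: "y(m := t) \<in> U \<inter> slice J \<sigma> c \<inter> {x. x m = t}" "y = (y(m := t))(m := 0)"
      using slice_upd[of y t] zero by (auto simp: cross_section_def)
    show "y \<in> (\<lambda>x. x(m := 0)) ` (U \<inter> slice J \<sigma> c \<inter> {x. x m = t})"
      by (rule rev_image_eqI[OF yt(1)]) (rule yt(2))
  next
    fix y assume "y \<in> (\<lambda>x. x(m := 0)) ` (U \<inter> slice J \<sigma> c \<inter> {x. x m = t})"
    then obtain x where "x \<in> U" "x \<in> slice J \<sigma> c" "x m = t" "y = x(m := 0)" by blast
    then show "y \<in> cross_section m t U \<inter> slice J \<sigma> c"
      using slice_upd[of x 0] sec by blast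
  qed
  show "(\<lambda>x. x(m := t)) ` (cross_section m t U \<inter> slice J \<sigma> c) = U \<inter> slice J \<sigma> c \<inter> {x. x m = t}"
  proof (intro set_eqI iffI)
    fix y assume y: "y \<in> U \<inter> slice J \<sigma> c \<inter> {x. x m = t}"
    then have y0: "y(m := 0) \<in> cross_section m t U \<inter> slice J \<sigma> c" "y = (y(m := 0))(m := t)"
      using slice_upd[of y 0] sec reinsert by auto
    show "y \<in> (\<lambda>x. x(m := t)) ` (cross_section m t U \<inter> slice J \<sigma> c)"
      by (rule rev_image_eqI[OF y0(1)]) (rule y0(2))
  next
    fix y assume "y \<in> (\<lambda>x. x(m := t)) ` (cross_section m t U \<inter> slice J \<sigma> c)"
    then obtain x where "x \<in> cross_section m t U" "x \<in> slice J \<sigma> c" "y = x(m := t)" by blast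
    then show "y \<in> U \<inter> slice J \<sigma> c \<inter> {x. x m = t}"
      using slice_upd[of x t] by (auto simp: cross_section_def)
  qed
qed

lemma slices_connected_cross_section:
  assumes "slices_connected (Suc m) U" "U \<subseteq> Rn (Suc m)"
  shows "slices_connected m (cross_section m t U)"
  unfolding slices_connected_def
proof (intro allI impI)
  fix J and \<sigma> :: "nat \<Rightarrow> real \<Rightarrow> real \<Rightarrow> bool" and c :: "nat \<Rightarrow> real"
  assume J: "J \<subseteq> {..<m}" "\<forall>j\<in>J. \<sigma> j \<in> {(<), (=), (>)}"
  let ?J = "insert m J" and ?\<sigma> = "\<sigma>(m := (=))" and ?c = "c(m := t)"
  have "m \<notin> J" using J(1) by blast
  then have "slice ?J ?\<sigma> ?c = slice J \<sigma> c \<inter> {x. x m = t}"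
    by auto
  moreover have "connected (U \<inter> slice ?J ?\<sigma> ?c)"
  proof -
    have "?J \<subseteq> {..<Suc m}" "\<forall>j\<in>?J. ?\<sigma> j \<in> {(<), (=), (>)}"
      using J by auto
    then show ?thesis
      by (rule slices_connectedD[OF assms(1)])
  qed
  ultimately have "connected (U \<inter> slice J \<sigma> c \<inter> {x. x m = t})"
    by (simp add: Int_assoc)
  then have "connected ((\<lambda>x. x(m := 0)) ` (U \<inter> slice J \<sigma> c \<inter> {x. x m = t}))"
    by (rule connected_continuous_image[OF continuous_on_upd_point])
  then show "connected (cross_section m t U \<inter> slice J \<sigma> c)"
    using cross_section_slice_image(1)[OF assms(2) J(1)] by simp
qed

section \<open>From connected slices to regular functions\<close>

text \<open>If both values of the bit \<open>a\<close> occur, the slice of \<open>U\<close> given by the conditions on the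
  other coordinates than \<open>a\<close>, \<open>b\<close> crosses \<open>x\<^sub>a = p\<^sub>a\<close>. A crossing point can be pushed to both
  sides of that hyperplane without changing the side for \<open>b\<close>.\<close>

lemma slices_connected_square:
  assumes "slices_connected n U" "openin (Euclidean_space n) U" "a < b" "b < n"
  shows "regular2 (\<lambda>s t. bf_at n U p (\<eta>(a := s, b := t)))"
  unfolding regular2_iff_common_value
proof (intro impI)
  have sub: "U \<subseteq> Rn n" using assms(2) openin_subset by blast
  let ?J = "{..<n} - {a, b}"
  let ?V = "U \<inter> {x. \<forall>i\<in>?J. if \<eta> i then x i > p i else x i < p i}"
  have V: "\<exists>x\<in>?V. if s then x a > p a else x a < p a" if "bf_at n U p (\<eta>(a := s, b := t))" for s t
  proof -
    obtain x where "x \<in> U" and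
      x: "\<And>i. i < n \<Longrightarrow> if (\<eta>(a := s, b := t)) i then x i > p i else x i < p i"
      using \<open>bf_at n U p (\<eta>(a := s, b := t))\<close> unfolding bf_at_iff[OF sub] by blast
    have "if \<eta> i then x i > p i else x i < p i" if "i \<in> ?J" for i
      using x[of i] that by auto
    moreover have "if s then x a > p a else x a < p a"
      using x[of a] assms(3,4) by (auto split: if_splits)
    ultimately show ?thesis using \<open>x \<in> U\<close> by blast
  qed
  assume meets: "(\<exists>t. bf_at n U p (\<eta>(a := False, b := t))) \<and> (\<exists>t. bf_at n U p (\<eta>(a := True, b := t)))"
  then have "\<exists>x\<in>?V. x a < p a"
    using V[of False] unfolding if_False by blast
  moreover have "\<exists>y\<in>?V. y a > p a"
    using V[of True] meets unfolding if_True by blast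
  moreover have "connected ?V"
    by (rule slices_connected_octant[OF assms(1)]) auto
  ultimately obtain z where z: "z \<in> ?V" "z a = p a"
    using connected_coordinate_value by blast
  have "bf_at n U p (\<eta>(a := s, b := z b > p b))" for s
  proof (rule bf_at_I[OF assms(2)])
    show "z \<in> U" using z by blast
    fix i assume "i < n" "z i \<noteq> p i"
    then show "(\<eta>(a := s, b := z b > p b)) i \<longleftrightarrow> z i > p i"
      using z assms(3) by (cases "i = a \<or> i = b") (auto split: if_splits)
  qed
  then show "\<exists>t. bf_at n U p (\<eta>(a := False, b := t)) \<and> bf_at n U p (\<eta>(a := True, b := t))"
    by blast
qed

text \<open>Regularity is needed here also at points of \<open>U\<close>: a point outside \<open>U\<close> may have its projection
  inside the projection of \<open>U\<close>.\<close>

lemma bf_at_outside_regular_if_slices_connected: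
  assumes "openin (Euclidean_space n) U" "slices_connected n U" "p \<in> Rn n"
  shows "bf_regular n (bf_at n U p) \<and> (p \<notin> U \<longrightarrow> (\<exists>\<xi>\<in>bcube n. \<not> bf_at n U p \<xi>))"
  using assms
proof (induction n arbitrary: U p)
  case 0
  have "U \<subseteq> {p}"
    using 0(3) openin_subset[OF 0(1)] by (auto simp: topspace_Euclidean_space fun_eq_iff)
  then have "U = {}" if "p \<notin> U"
    using that by blast
  then have "\<not> bf_at 0 U p (\<lambda>_. False)" if "p \<notin> U"
    using that by (simp add: bf_at_def)
  moreover have "(\<lambda>_. False) \<in> bcube 0" by (simp add: bcube_def)
  ultimately show ?case by auto
next
  case (Suc m)
  have sub: "U \<subseteq> Rn (Suc m)" using Suc.prems(1) openin_subset by blast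
  let ?\<psi> = "bf_at (Suc m) U p" and ?q = "p(m := 0)" and ?W = "cross_section m (p m) U"
  \<comment> \<open>the last coordinate of \<open>p\<close> is invisible in dimension \<open>m\<close>, so \<open>p\<close> can stand for its projection\<close>
  have cong: "bf_at m V p = bf_at m V ?q" for V
    by (auto simp: bf_at_def octant_def fun_eq_iff)
  have q: "?q \<in> Rn m" using Suc.prems(3) Rn_Suc_forget by blast
  have E: "bf_E m ?\<psi> = bf_at m (shadow m U) ?q"
    using bf_E_bf_at[OF Suc.prems(1)] cong by simp
  have A: "bf_A m ?\<psi> = bf_at m ?W ?q"
  proof
    fix \<xi>
    have "connected (U \<inter> {x. \<forall>i<m. if \<xi> i then x i > p i else x i < p i})"
      using slices_connected_octant[OF Suc.prems(2), of "{..<m}" \<xi> p] by (simp add: Ball_def)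
    then show "bf_A m ?\<psi> \<xi> = bf_at m ?W ?q \<xi>"
      using bf_A_bf_at[OF Suc.prems(1)] cong by simp
  qed
  have IH_E: "bf_regular m (bf_at m (shadow m U) ?q)"
    using Suc.IH[OF openin_shadow slices_connected_shadow] Suc.prems q by blast
  have IH_A: "bf_regular m (bf_at m ?W ?q)" "?q \<notin> ?W \<Longrightarrow> \<exists>\<xi>\<in>bcube m. \<not> bf_at m ?W ?q \<xi>"
    using Suc.IH[OF openin_cross_section slices_connected_cross_section] Suc.prems q sub by blast+
  have "bf_regular (Suc m) ?\<psi>"
    unfolding bf_regular_Suc E A
    using IH_E IH_A slices_connected_square[OF Suc.prems(2,1)] by blast
  moreover have "\<exists>\<xi>\<in>bcube (Suc m). \<not> ?\<psi> \<xi>" if "p \<notin> U"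
  proof -
    have "?q \<notin> ?W" using that by (simp add: cross_section_def)
    then obtain \<xi> where "\<xi> \<in> bcube m" "\<not> bf_A m ?\<psi> \<xi>"
      using IH_A A by auto
    then show ?thesis
      using bcube_Suc_upd by (auto simp: bf_A_def bf_restrict_def)
  qed
  ultimately show ?case by blast
qed

section \<open>From regular functions to connected slices\<close>

text \<open>The empty set is admitted, since sections may be empty; hence the functions are only required
  not to be constantly true.\<close>

definition regular_outside :: "nat \<Rightarrow> (nat \<Rightarrow> real) set \<Rightarrow> bool" where
  "regular_outside n U \<longleftrightarrow>
     (\<forall>p\<in>Rn n - U. bf_regular n (bf_at n U p) \<and> (\<exists>\<xi>\<in>bcube n. \<not> bf_at n U p \<xi>))"

text \<open>From a point of \<open>U\<close> on the line above \<open>s\<close>, all octants on that side of \<open>x(j := s)\<close> are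
  reached by small perturbations, and likewise from below.\<close>

lemma regular_outside_line_convex:
  assumes "openin (Euclidean_space n) U" "regular_outside n U" "j < n"
    and "x(j := r) \<in> U" "x(j := t) \<in> U" "r < s" "s < t"
  shows "x(j := s) \<in> U"
proof (rule ccontr)
  let ?p = "x(j := s)"
  assume "?p \<notin> U"
  moreover have "x(j := r) \<in> Rn n"
    using openin_subset[OF assms(1)] assms(4) by blast
  then have "?p \<in> Rn n"
    using Rn_upd[OF _ assms(3), of "x(j := r)" s] by simp
  ultimately obtain \<xi> where \<xi>: "\<not> bf_at n U ?p \<xi>"
    using assms(2) unfolding regular_outside_def by fastforce
  show False
  proof (cases "\<xi> j")
    case True
    then have "bf_at n U ?p \<xi>"
      using assms(7) by (intro bf_at_I[OF assms(1,5)]) (auto split: if_splits)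
    with \<xi> show False ..
  next
    case False
    then have "bf_at n U ?p \<xi>"
      using assms(6) by (intro bf_at_I[OF assms(1,4)]) (auto split: if_splits)
    with \<xi> show False ..
  qed
qed

lemma bounded_Rn_shadow: "bounded_Rn (Suc m) U \<Longrightarrow> bounded_Rn m (shadow m U)"
  unfolding bounded_Rn_def shadow_def by (fastforce simp: less_Suc_eq)

lemma bounded_Rn_cross_section: "bounded_Rn (Suc m) U \<Longrightarrow> bounded_Rn m (cross_section m c U)"
  unfolding bounded_Rn_def cross_section_def
  by (smt (verit, best) fun_upd_apply less_SucI less_irrefl mem_Collect_eq)

text \<open>Think of \<open>\<psi>\<close> at a point whose height is such that \<open>U\<close> is nowhere above it over the octant
  \<open>\<xi>0\<close>. The octants with \<open>A \<psi> = 0\<close> are those over which \<open>U\<close> lies on only one side of this height.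
  They form a connected part of the cube, and the side cannot change along an edge of it, because
  that would be a forbidden square. So all of them lie below.\<close>

lemma bf_regular_propagate_below:
  assumes reg: "bf_regular (Suc m) \<psi>"
    and E: "\<And>\<xi>. \<xi> \<in> bcube m \<Longrightarrow> bf_E m \<psi> \<xi>"
    and \<xi>0: "\<xi>0 \<in> bcube m" "\<not> \<psi> (\<xi>0(m := True))"
    and \<xi>: "\<xi> \<in> bcube m"
  shows "\<psi> (\<xi>(m := False))"
proof (rule ccontr)
  assume neg: "\<not> \<psi> (\<xi>(m := False))"
  let ?\<chi> = "\<lambda>\<xi>. \<not> bf_A m \<psi> \<xi>"
  have "bf_regular m ?\<chi>"
    using reg by (simp add: bf_regular_Not bf_regular_Suc)
  moreover have "?\<chi> \<xi>0" "?\<chi> \<xi>"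
    using \<xi>0 neg by (auto simp: bf_A_def bf_restrict_def)
  ultimately have "(flip_step m ?\<chi>)\<^sup>*\<^sup>* \<xi>0 \<xi>"
    using bf_regular_connected \<xi>0 \<xi> by blast
  then have "\<not> \<psi> (\<xi>(m := True))"
  proof (induction rule: rtranclp_induct)
    case base
    show ?case by (fact \<xi>0(2))
  next
    case (step \<zeta> \<theta>)
    then obtain i where i: "i < m" "\<zeta> \<in> bcube m" "\<theta> \<in> bcube m" "?\<chi> \<theta>" "\<theta> = \<zeta>(i := \<not> \<zeta> i)"
      by (auto simp: flip_step_def)
    then obtain r where r: "\<psi> (\<zeta>(m := r))" "\<psi> (\<theta>(m := r))"
      using regular_square_common_value[OF reg, of i \<zeta>] E by auto
    have "r \<noteq> True" using r(1) step.IH by blast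
    then have "\<psi> (\<theta>(m := False))" using r(2) by simp
    then show ?case
      using i(4) unfolding bf_A_def bf_restrict_def by blast
  qed
  with neg E[OF \<xi>] show False
    by (auto simp: bf_E_def bf_restrict_def)
qed

text \<open>Suppose that \<open>U\<close> has points over every octant at \<open>p\<close>. Raise the height to the least value \<open>t\<close>
  at which \<open>U\<close> has, over some octant, no point above it. At this height \<open>U\<close> has points below
  over every octant by \<open>bf_regular_propagate_below\<close>. Slightly lower, there are points of \<open>U\<close> both above and
  below over every octant, so the Boolean function is constantly true at a point outside \<open>U\<close>.\<close>

lemma regular_outside_shadow_nonfull:
  assumes op: "openin (Euclidean_space (Suc m)) U" and bd: "bounded_Rn (Suc m) U"
    and reg: "regular_outside (Suc m) U" and p: "p \<in> Rn m - shadow m U"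
  shows "\<exists>\<xi>\<in>bcube m. \<not> bf_at m (shadow m U) p \<xi>"
proof (rule ccontr)
  assume "\<not> ?thesis"
  then have full: "\<And>\<xi>. \<xi> \<in> bcube m \<Longrightarrow> bf_at m (shadow m U) p \<xi>" by blast
  have sub: "U \<subseteq> Rn (Suc m)" using op openin_subset by blast
  have outside: "p(m := t) \<in> Rn (Suc m) - U" for t
    using p Rn_Suc_upd by (auto simp: shadow_eq_Union[OF sub] cross_section_def)
  \<comment> \<open>the heights of the points of \<open>U\<close> over the octant \<open>\<xi>\<close>\<close>
  define H where "H \<xi> = (\<lambda>x. x m) ` {x \<in> U. \<forall>i<m. if \<xi> i then x i > p i else x i < p i}" for \<xi>
  have \<psi>: "bf_at (Suc m) U (p(m := t)) (\<xi>(m := s)) \<longleftrightarrow> (\<exists>h\<in>H \<xi>. if s then h > t else h < t)" for t \<xi> s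
    unfolding bf_at_Suc_upd[OF sub] H_def by (auto simp: Ball_def)
  have H_ne: "H \<xi> \<noteq> {}" if "\<xi> \<in> bcube m" for \<xi>
    using full[OF that] unfolding bf_at_shadow_iff[OF sub] by (auto simp: H_def)
  obtain B where "\<forall>x\<in>U. \<forall>i<Suc m. \<bar>x i\<bar> \<le> B"
    using bd by (auto simp: bounded_Rn_def)
  then have bdd: "bdd_above (H \<xi>)" for \<xi>
    by (intro bdd_aboveI[of _ B]) (force simp: H_def)
  have cube_ne: "bcube m \<noteq> {}"
    by (auto simp: bcube_def)
  define t where "t = Min ((\<lambda>\<xi>. Sup (H \<xi>)) ` bcube m)"
  have "t \<in> (\<lambda>\<xi>. Sup (H \<xi>)) ` bcube m"
    unfolding t_def using finite_bcube cube_ne by (intro Min_in) auto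
  then obtain \<xi>0 where \<xi>0: "\<xi>0 \<in> bcube m" "t = Sup (H \<xi>0)" by blast
  have t_le: "t \<le> Sup (H \<xi>)" if "\<xi> \<in> bcube m" for \<xi>
    unfolding t_def using finite_bcube that by (intro Min_le) auto
  let ?\<psi> = "bf_at (Suc m) U (p(m := t))"
  have "bf_regular (Suc m) ?\<psi>"
    using reg outside unfolding regular_outside_def by blast
  moreover have "bf_E m ?\<psi> \<xi>" if "\<xi> \<in> bcube m" for \<xi>
  proof -
    have "bf_at m V (p(m := t)) = bf_at m V p" for V
      by (auto simp: bf_at_def octant_def fun_eq_iff)
    then show ?thesis using full[OF that] bf_E_bf_at[OF op] by simp
  qed
  moreover have "\<not> ?\<psi> (\<xi>0(m := True))"
    unfolding \<psi> using cSup_upper[OF _ bdd, of _ \<xi>0] \<xi>0(2) by fastforce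
  ultimately have below: "?\<psi> (\<xi>(m := False))" if "\<xi> \<in> bcube m" for \<xi>
    using bf_regular_propagate_below that \<xi>0(1) by blast
  then have "\<forall>\<xi>\<in>bcube m. \<exists>h\<in>H \<xi>. h < t"
    unfolding \<psi> by auto
  then obtain h where h: "\<And>\<xi>. \<xi> \<in> bcube m \<Longrightarrow> h \<xi> \<in> H \<xi> \<and> h \<xi> < t"
    by metis
  have "Max (h ` bcube m) < t"
    using h finite_bcube cube_ne by (subst Max_less_iff) auto
  then obtain t' where t': "Max (h ` bcube m) < t'" "t' < t"
    using dense by blast
  have "bf_at (Suc m) U (p(m := t')) \<zeta>" if \<zeta>: "\<zeta> \<in> bcube (Suc m)" for \<zeta>
  proof -
    let ?\<xi> = "\<zeta>(m := False)"
    have \<xi>: "?\<xi> \<in> bcube m" using \<zeta> by (rule bcube_upd_False)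
    have "\<exists>k\<in>H ?\<xi>. k > t'"
      using less_cSupD[OF H_ne[OF \<xi>]] t_le[OF \<xi>] t'(2) by force
    moreover have "h ?\<xi> < t'"
      using Max_ge[OF finite_imageI[OF finite_bcube], of "h ?\<xi>" h m] \<xi> t'(1) by force
    ultimately have "bf_at (Suc m) U (p(m := t')) (?\<xi>(m := \<zeta> m))"
      unfolding \<psi> using h[OF \<xi>] by auto
    then show ?thesis by simp
  qed
  then show False
    using reg outside[of t'] unfolding regular_outside_def by blast
qed

lemma regular_outside_shadow:
  assumes "openin (Euclidean_space (Suc m)) U" "bounded_Rn (Suc m) U" "regular_outside (Suc m) U"
  shows "regular_outside m (shadow m U)"
  unfolding regular_outside_def
proof (intro ballI conjI)
  fix p assume p: "p \<in> Rn m - shadow m U"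
  have "p = p(m := 0)" using p by (auto simp: topspace_Euclidean_space)
  moreover have "p \<in> Rn (Suc m)" using p by (auto simp: topspace_Euclidean_space)
  ultimately have "p \<in> Rn (Suc m) - U"
    using p unfolding shadow_def by (metis DiffD2 DiffI imageI)
  then have "bf_regular (Suc m) (bf_at (Suc m) U p)"
    using assms(3) unfolding regular_outside_def by blast
  then show "bf_regular m (bf_at m (shadow m U) p)"
    by (simp add: bf_regular_Suc bf_E_bf_at[OF assms(1)])
  show "\<exists>\<xi>\<in>bcube m. \<not> bf_at m (shadow m U) p \<xi>"
    using regular_outside_shadow_nonfull[OF assms p] .
qed

text \<open>The projection restricted to the slice is open onto its image: the slice is the full preimage in
  \<open>U\<close> of a set in \<open>\<real>\<^sup>m\<close>, so a point over a nearby base point at the same height stays in it.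
  Its fibres are intervals, so connectedness lifts from the base.\<close>

lemma connected_slice_free_last:
  assumes op: "openin (Euclidean_space (Suc m)) U" and reg: "regular_outside (Suc m) U"
    and conn: "connected (shadow m U \<inter> slice J \<sigma> c)" and J: "J \<subseteq> {..<m}"
  shows "connected (U \<inter> slice J \<sigma> c)"
proof -
  let ?V = "U \<inter> slice J \<sigma> c" and ?f = "\<lambda>x::nat \<Rightarrow> real. x(m := 0)"
  obtain G where G: "open G" "U = Rn (Suc m) \<inter> G"
    using op openin_Rn_iff by auto
  have slice_upd: "x(m := a) \<in> slice J \<sigma> c \<longleftrightarrow> x \<in> slice J \<sigma> c" for a x
    using J by fastforce
  have im: "?f ` ?V = shadow m U \<inter> slice J \<sigma> c"
    using slice_upd unfolding shadow_def by blast
  have "connected (?V \<inter> ?f -` (shadow m U \<inter> slice J \<sigma> c))"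
  proof (rule connected_open_monotone_preimage[OF continuous_on_upd_point im _ _ conn order_refl])
    fix W assume "openin (top_of_set ?V) W"
    then obtain Q where Q: "open Q" "W = ?V \<inter> Q"
      by (auto simp: openin_open)
    show "openin (top_of_set (shadow m U \<inter> slice J \<sigma> c)) (?f ` W)"
    proof (subst openin_subopen, intro ballI)
      fix y assume "y \<in> ?f ` W"
      then obtain x where x: "x \<in> W" "y = ?f x" by blast
      let ?N = "{y. y(m := x m) \<in> G \<inter> Q}"
      have "?N \<inter> (shadow m U \<inter> slice J \<sigma> c) \<subseteq> ?f ` W"
      proof
        fix z assume z: "z \<in> ?N \<inter> (shadow m U \<inter> slice J \<sigma> c)"
        then obtain u where u: "u \<in> U" "z = u(m := 0)"
          by (auto simp: shadow_def)
        have "u(m := x m) \<in> Rn (Suc m)"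
          using u(1) G(2) by (intro Rn_upd) auto
        then have "u(m := x m) \<in> W"
          using z u G(2) Q(2) slice_upd[of u 0] slice_upd[of u "x m"] by auto
        moreover have "z = ?f (u(m := x m))" using u by simp
        ultimately show "z \<in> ?f ` W" by blast
      qed
      moreover have "y \<in> ?N \<inter> (shadow m U \<inter> slice J \<sigma> c)"
      proof -
        have "x \<in> U" "x \<in> slice J \<sigma> c" "x \<in> Q" "x \<in> G" using x Q(2) G(2) by auto
        then have "y \<in> shadow m U" "y \<in> slice J \<sigma> c" "y(m := x m) \<in> G \<inter> Q"
          using x(2) slice_upd[of x 0] by (auto simp: shadow_def)
        then show ?thesis by blast
      qed
      moreover have "openin (top_of_set (shadow m U \<inter> slice J \<sigma> c)) (?N \<inter> (shadow m U \<inter> slice J \<sigma> c))"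
        by (subst Int_commute[of ?N]) (intro openin_open_Int open_vimage_upd_point open_Int G(1) Q(1))
      ultimately show "\<exists>T. openin (top_of_set (shadow m U \<inter> slice J \<sigma> c)) T \<and> y \<in> T \<and> T \<subseteq> ?f ` W"
        by blast
    qed
  next
    fix y assume y: "y \<in> shadow m U \<inter> slice J \<sigma> c"
    let ?T = "{t. y(m := t) \<in> U}"
    have "connected ?T"
      unfolding connected_iff_interval
      using regular_outside_line_convex[OF op reg lessI, of y]
      by (metis (mono_tags, lifting) mem_Collect_eq order_le_less)
    then have "connected ((\<lambda>t. y(m := t)) ` ?T)"
      by (rule connected_continuous_image[OF continuous_on_upd_coordinate])
    also have "(\<lambda>t. y(m := t)) ` ?T = ?V \<inter> ?f -` {y}"
    proof (intro set_eqI iffI)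
      fix x assume "x \<in> ?V \<inter> ?f -` {y}"
      then have "x = y(m := x m)" "x \<in> U" by auto
      then show "x \<in> (\<lambda>t. y(m := t)) ` ?T"
        by (metis (mono_tags, lifting) image_eqI mem_Collect_eq)
    next
      fix x assume "x \<in> (\<lambda>t. y(m := t)) ` ?T"
      then obtain t where t: "x = y(m := t)" "y(m := t) \<in> U" by auto
      have "y m = 0" using y by (auto simp: shadow_def)
      then have "?f x = y" using t by auto
      with t y slice_upd[of y t] show "x \<in> ?V \<inter> ?f -` {y}" by auto
    qed
    finally show "connected (?V \<inter> ?f -` {y})" .
  qed
  moreover have "?V \<inter> ?f -` (shadow m U \<inter> slice J \<sigma> c) = ?V"
    using im by blast
  ultimately show ?thesis by simp
qed

text \<open>The identification of \<open>A \<psi>\<close> with the function of the section requires connected slices of \<open>U\<close>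
  without a condition on \<open>x\<^sub>m\<close>; these come from the projection.\<close>

lemma regular_outside_cross_section:
  assumes op: "openin (Euclidean_space (Suc m)) U" and reg: "regular_outside (Suc m) U"
    and shadow: "slices_connected m (shadow m U)"
  shows "regular_outside m (cross_section m c U)"
  unfolding regular_outside_def
proof (intro ballI)
  fix p assume p: "p \<in> Rn m - cross_section m c U"
  let ?p = "p(m := c)"
  have A: "bf_A m (bf_at (Suc m) U ?p) = bf_at m (cross_section m c U) p"
  proof
    fix \<xi>
    let ?\<sigma> = "(\<lambda>i. if \<xi> i then (>) else (<)) :: nat \<Rightarrow> real \<Rightarrow> real \<Rightarrow> bool"
    have "connected (U \<inter> slice {..<m} ?\<sigma> ?p)"
      by (intro connected_slice_free_last[OF op reg] slices_connectedD[OF shadow]) auto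
    also have "slice {..<m} ?\<sigma> ?p = {x. \<forall>i<m. if \<xi> i then x i > ?p i else x i < ?p i}"
      by (auto split: if_splits)
    finally have "bf_A m (bf_at (Suc m) U ?p) \<xi> = bf_at m (cross_section m c U) ?p \<xi>"
      using bf_A_bf_at[OF op] by simp
    also have "\<dots> = bf_at m (cross_section m c U) p \<xi>"
      by (auto simp: bf_at_def octant_def)
    finally show "bf_A m (bf_at (Suc m) U ?p) \<xi> = bf_at m (cross_section m c U) p \<xi>" .
  qed
  have "?p \<in> Rn (Suc m) - U"
    using p Rn_Suc_upd by (auto simp: cross_section_def)
  then have "bf_regular (Suc m) (bf_at (Suc m) U ?p)"
      and nonfull: "\<exists>\<xi>\<in>bcube (Suc m). \<not> bf_at (Suc m) U ?p \<xi>"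
    using reg unfolding regular_outside_def by blast+
  then have "bf_regular m (bf_A m (bf_at (Suc m) U ?p))"
    unfolding bf_regular_Suc by blast
  moreover have "\<exists>\<xi>\<in>bcube m. \<not> bf_A m \<psi> \<xi>" if "\<zeta> \<in> bcube (Suc m)" "\<not> \<psi> \<zeta>" for \<psi> \<zeta>
  proof
    show "\<zeta>(m := False) \<in> bcube m" using that(1) by (rule bcube_upd_False)
    have "\<zeta>(m := \<zeta> m) = \<zeta>" by simp
    with that(2) show "\<not> bf_A m \<psi> (\<zeta>(m := False))"
      by (cases "\<zeta> m") (auto simp: bf_A_def bf_restrict_def)
  qed
  ultimately show "bf_regular m (bf_at m (cross_section m c U) p) \<and>
      (\<exists>\<xi>\<in>bcube m. \<not> bf_at m (cross_section m c U) p \<xi>)"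
    using nonfull unfolding A[symmetric] by blast
qed

text \<open>The function \<open>x\<^sub>m\<close> is an open map from the slice to the real line, because the slice constrains
  only the other coordinates. Its fibres are slices of sections and its image is an interval.\<close>

lemma connected_slice_last_in:
  assumes op: "openin (Euclidean_space (Suc m)) U" and J: "J \<subseteq> {..<m}"
    and free: "connected (U \<inter> slice J \<sigma> c)"
    and sections: "\<And>t. connected (cross_section m t U \<inter> slice J \<sigma> c)"
    and I: "connected I"
  shows "connected (U \<inter> slice J \<sigma> c \<inter> {x. x m \<in> I})"
proof -
  let ?V = "U \<inter> slice J \<sigma> c" and ?f = "\<lambda>x::nat \<Rightarrow> real. x m"
  obtain G where G: "open G" "U = Rn (Suc m) \<inter> G"
    using op openin_Rn_iff by auto
  have "connected (?f ` ?V)"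
    using free by (rule connected_continuous_image[OF continuous_on_coordinate])
  then have base: "connected (?f ` ?V \<inter> I)"
    using I by (simp add: is_interval_connected_1[symmetric] is_interval_Int)
  have "connected (?V \<inter> ?f -` (?f ` ?V \<inter> I))"
  proof (rule connected_open_monotone_preimage[OF continuous_on_coordinate refl _ _ base Int_lower1])
    fix W assume "openin (top_of_set ?V) W"
    then obtain Q where Q: "open Q" "W = ?V \<inter> Q"
      by (auto simp: openin_open)
    have "open (?f ` W)"
    proof (subst open_subopen, intro ballI)
      fix s assume "s \<in> ?f ` W"
      then obtain x where x: "x \<in> W" "s = x m" by blast
      have "t \<in> ?f ` W" if "x(m := t) \<in> G \<inter> Q" for t
      proof -
        have "x(m := t) \<in> Rn (Suc m)"
          using x(1) Q(2) G(2) by (intro Rn_upd) auto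
        moreover have "x(m := t) \<in> slice J \<sigma> c"
          using x(1) Q(2) J by fastforce
        ultimately have "x(m := t) \<in> W" using that Q(2) G(2) by blast
        then show ?thesis by (rule rev_image_eqI) simp
      qed
      moreover have "x(m := s) \<in> G \<inter> Q" using x Q(2) G(2) by simp
      ultimately show "\<exists>T. open T \<and> s \<in> T \<and> T \<subseteq> ?f ` W"
        using open_vimage_upd_coordinate[OF open_Int[OF G(1) Q(1)], of x m] by blast
    qed
    moreover have "?f ` W \<subseteq> ?f ` ?V" using Q(2) by blast
    ultimately show "openin (top_of_set (?f ` ?V)) (?f ` W)"
      by (simp add: open_subset)
  next
    fix t assume "t \<in> ?f ` ?V"
    have "connected ((\<lambda>x. x(m := t)) ` (cross_section m t U \<inter> slice J \<sigma> c))"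
      using sections by (rule connected_continuous_image[OF continuous_on_upd_point])
    also have "(\<lambda>x. x(m := t)) ` (cross_section m t U \<inter> slice J \<sigma> c) = ?V \<inter> {x. x m = t}"
      using cross_section_slice_image(2)[OF _ J] G(2) by blast
    also have "{x. x m = t} = ?f -` {t}" by auto
    finally show "connected (?V \<inter> ?f -` {t})" .
  qed
  moreover have "?V \<inter> ?f -` (?f ` ?V \<inter> I) = ?V \<inter> {x. x m \<in> I}"
    by blast
  ultimately show ?thesis by simp
qed

lemma slices_connected_if_regular_outside:
  assumes "openin (Euclidean_space n) U" "bounded_Rn n U" "regular_outside n U"
  shows "slices_connected n U"
  using assms
proof (induction n arbitrary: U)
  case 0
  have "connected (U \<inter> A)" for A
  proof -
    have "U \<inter> A \<subseteq> {\<lambda>_. 0}"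
      using openin_subset[OF 0(1)] by (auto simp: topspace_Euclidean_space)
    then show ?thesis by (metis connected_empty connected_sing subset_singletonD)
  qed
  then show ?case unfolding slices_connected_def by blast
next
  case (Suc m)
  note op = Suc.prems(1) and bd = Suc.prems(2) and reg = Suc.prems(3)
  have shadow: "slices_connected m (shadow m U)"
    using Suc.IH openin_shadow[OF op] bounded_Rn_shadow[OF bd] regular_outside_shadow[OF op bd reg] .
  have sections: "slices_connected m (cross_section m t U)" for t
    using Suc.IH openin_cross_section[OF op] bounded_Rn_cross_section[OF bd]
      regular_outside_cross_section[OF op reg shadow] .
  show ?case
    unfolding slices_connected_def
  proof (intro allI impI)
    fix J and \<sigma> :: "nat \<Rightarrow> real \<Rightarrow> real \<Rightarrow> bool" and c :: "nat \<Rightarrow> real"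
    assume J: "J \<subseteq> {..<Suc m}" "\<forall>j\<in>J. \<sigma> j \<in> {(<), (=), (>)}"
    define K where "K = J - {m}"
    have K: "K \<subseteq> {..<m}" "\<forall>j\<in>K. \<sigma> j \<in> {(<), (=), (>)}"
      using J by (auto simp: K_def less_Suc_eq)
    \<comment> \<open>the condition on the last coordinate, if any, as a set of admissible values\<close>
    define I where "I = (if m \<in> J then {t. \<sigma> m t (c m)} else UNIV)"
    have "connected I"
    proof (cases "m \<in> J")
      case True
      then have "I \<in> {{..<c m}, {c m}, {c m<..}}"
        using J(2) by (auto simp: I_def)
      then show ?thesis by auto
    qed (simp add: I_def)
    moreover have "connected (U \<inter> slice K \<sigma> c)"
      using connected_slice_free_last[OF op reg slices_connectedD[OF shadow K] K(1)] .
    moreover have "connected (cross_section m t U \<inter> slice K \<sigma> c)" for t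
      using slices_connectedD[OF sections K] .
    ultimately have "connected (U \<inter> slice K \<sigma> c \<inter> {x. x m \<in> I})"
      using connected_slice_last_in[OF op K(1)] by blast
    also have "U \<inter> slice K \<sigma> c \<inter> {x. x m \<in> I} = U \<inter> slice J \<sigma> c"
      by (auto simp: K_def I_def)
    finally show "connected (U \<inter> slice J \<sigma> c)" .
  qed
qed

section \<open>The characterization of semi-monotone sets\<close>

lemma bf_at_nonzero:
  assumes "openin (Euclidean_space n) U" "U \<noteq> {}"
  shows "\<exists>\<xi>\<in>bcube n. bf_at n U p \<xi>"
proof -
  obtain x where "x \<in> U" using assms(2) by blast
  then have "bf_at n U p (\<lambda>i. i < n \<and> x i > p i)"
    by (intro bf_at_I[OF assms(1)]) auto
  then show ?thesis by (intro bexI) (auto simp: bcube_def)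
qed

theorem theorem5p9:
  fixes S :: "nat \<Rightarrow> (nat \<Rightarrow> real) set set" and n :: nat and U :: "(nat \<Rightarrow> real) set"
  assumes "o_minimal_structure S"
    and "n \<ge> 1"
    and "U \<noteq> {}"
    and "openin (Euclidean_space n) U"
    and "bounded_Rn n U"
    and "U \<in> S n"
  shows "semi_monotone S n U \<longleftrightarrow>
    (\<forall>p \<in> Rn n - U. bf_nonconstant n (bf_at n U p) \<and> bf_regular n (bf_at n U p))"
proof -
  have "bf_nonconstant n (bf_at n U p) \<longleftrightarrow> (\<exists>\<xi>\<in>bcube n. \<not> bf_at n U p \<xi>)" for p
    using bf_at_nonzero[OF assms(4,3)] unfolding bf_nonconstant_def by blast
  then have "(\<forall>p \<in> Rn n - U. bf_nonconstant n (bf_at n U p) \<and> bf_regular n (bf_at n U p)) \<longleftrightarrow>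
      regular_outside n U"
    unfolding regular_outside_def by blast
  moreover have "slices_connected n U \<longleftrightarrow> regular_outside n U"
    using slices_connected_if_regular_outside[OF assms(4,5)]
      bf_at_outside_regular_if_slices_connected[OF assms(4)]
    unfolding regular_outside_def by blast
  ultimately show ?thesis
    using semi_monotone_iff_slices_connected[of U S n, OF assms(6,4,5)] by simp
qed

end
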